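(* Let $\Lambda\subset\mathbb{N}_0^d$ be an arbitrary finite index set. The tent-transformed and then cosine-transformed rank-1 lattice rule $Q_n$ with $n$ points and generating vector $\boldsymbol{z}\in\mathbb{Z}^d$ integrates exactly (against the Chebyshev density) all Chebyshev space functions $f\in\mathcal{F}^{\rm Cheb}_\Lambda$ solely supported on $\Lambda$ if and only if $$\boldsymbol{h}\cdot\boldsymbol{z}\not\equiv0\pmod n\qquad\text{for all }\boldsymbol{h}\in\mathcal{M}(\Lambda)\setminus\{\boldsymbol{0}\}.$$ Such a generating vector $\boldsymbol{z}$ can be constructed component-by-component if $n$ is a prime satisfying $$n>\max\Big\{\frac{\#(\mathcal{M}(\Lambda)\setminus\{\boldsymbol{0}\})}{2}+1,\ \max(\Lambda)\Big\}.$$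
   Context: Chebyshev basis on $[-1,1]^d$: $\eta_{\boldsymbol{k}}(\boldsymbol{x})=\sqrt2^{\,|\boldsymbol{k}|_0}\prod_{j=1}^dT_{k_j}(x_j)$, $\boldsymbol{k}\in\mathbb{N}_0^d$, $T_k(x)=\cos(k\arccos x)$, $|\boldsymbol{k}|_0$ the number of nonzero components. $\mathcal{F}^{\rm Cheb}_\Lambda$ is the set of real-valued functions $f=\sum_{\boldsymbol{k}\in\Lambda}\widehat f_{\boldsymbol{k}}\,\eta_{\boldsymbol{k}}$ on $[-1,1]^d$. The rule is $Q_n(f)=\frac1n\sum_{i=0}^{n-1}f(\cos(2\pi i\boldsymbol{z}/n))$ (cosine applied componentwise); exact integration means $Q_n(f)=\int_{[-1,1]^d}f(\boldsymbol{x})\,\mu(d\boldsymbol{x})$ with $\mu(d\boldsymbol{x})=d\boldsymbol{x}/\prod_{j=1}^d(\pi\sqrt{1-x_j^2})$. $\mathcal{M}(\Lambda)=\{(\sigma_1k_1,\ldots,\sigma_dk_d):\boldsymbol{k}\in\Lambda,\boldsymbol{\sigma}\in\{\pm1\}^d\}$; $\max(\Lambda)=\max_{\boldsymbol{k}\in\Lambda}\max_j|k_j|$; $\#$ is cardinality. "Constructed component-by-component": for an index set $\mathcal{A}\subset\mathbb{Z}^d$ (here $\mathcal{A}=\mathcal{M}(\Lambda)$) and its projections $\mathcal{A}_s$, $s=1,\ldots,d$, given either by $\mathcal{A}_s=\{\boldsymbol{h}\in\mathbb{Z}^s:(\boldsymbol{h},\boldsymbol{0})\in\mathcal{A}\}$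 or by $\mathcal{A}_s=\{\boldsymbol{h}\in\mathbb{Z}^s:(\boldsymbol{h},\boldsymbol{h}_\perp)\in\mathcal{A}\text{ for some }\boldsymbol{h}_\perp\}$, the components $z_1,\ldots,z_d\in\{1,\ldots,n-1\}$ can be chosen one at a time: whenever $z_1,\ldots,z_{s-1}$ satisfy $\boldsymbol{h}\cdot(z_1,\ldots,z_{s-1})\not\equiv0\pmod n$ for all $\boldsymbol{h}\in\mathcal{A}_{s-1}\setminus\{\boldsymbol{0}\}$ (no condition if $s=1$), there exists $z_s\in\{1,\ldots,n-1\}$ with $\boldsymbol{h}\cdot(z_1,\ldots,z_s)\not\equiv0\pmod n$ for all $\boldsymbol{h}\in\mathcal{A}_s\setminus\{\boldsymbol{0}\}$. Since $\mathcal{A}_d=\mathcal{A}$, the resulting $\boldsymbol{z}$ satisfies the required condition. *)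

theory Defs
  imports "HOL-Analysis.Analysis" "HOL-Number_Theory.Cong"
begin

text \<open>
  Multi-indices and generating vectors of dimension \<open>s\<close> are lists of length \<open>s\<close>, so that vectors
  of different dimensions can be concatenated and extended one component at a time. Points of
  \<open>\<real>\<^sup>d\<close> are extensional functions on \<open>{..<d}\<close>, the carrier of the finite product measures.
  Components are counted from 0.
\<close>

definition cheb_cube :: "nat \<Rightarrow> (nat \<Rightarrow> real) set"
  where "cheb_cube d = (\<Pi>\<^sub>E j\<in>{..<d}. {-1..1})"

definition cheb_measure :: "nat \<Rightarrow> (nat \<Rightarrow> real) measure"
  where "cheb_measure d =
    density (restrict_space (\<Pi>\<^sub>M j\<in>{..<d}. lborel) (cheb_cube d))
      (\<lambda>x. ennreal (1 / (\<Prod>j<d. pi * sqrt (1 - (x j)\<^sup>2))))"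

definition cheb_T :: "nat \<Rightarrow> real \<Rightarrow> real"
  where "cheb_T k x = cos (real k * arccos x)"

definition num_nonzero :: "nat list \<Rightarrow> nat"
  where "num_nonzero k = card {j. j < length k \<and> k ! j \<noteq> 0}"

definition cheb_basis :: "nat list \<Rightarrow> (nat \<Rightarrow> real) \<Rightarrow> real"
  where "cheb_basis k x = sqrt 2 ^ num_nonzero k * (\<Prod>j<length k. cheb_T (k ! j) (x j))"

text \<open>Only the values on the cube matter; a member may take any values outside it.\<close>

definition cheb_space :: "nat \<Rightarrow> nat list set \<Rightarrow> ((nat \<Rightarrow> real) \<Rightarrow> real) set"
  where "cheb_space d \<Lambda> =
    {f. \<exists>c :: nat list \<Rightarrow> real. \<forall>x\<in>cheb_cube d. f x = (\<Sum>k\<in>\<Lambda>. c k * cheb_basis k x)}"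

definition cheb_rule :: "nat \<Rightarrow> int list \<Rightarrow> ((nat \<Rightarrow> real) \<Rightarrow> real) \<Rightarrow> real"
  where "cheb_rule n z f =
    (1 / real n) *
    (\<Sum>i<n. f (\<lambda>j\<in>{..<length z}. cos (2 * pi * real i * real_of_int (z ! j) / real n)))"

text \<open>
  Applying the tent transform and then \<open>cos (pi * _)\<close> to the lattice point component
  \<open>frac (i * z\<^sub>j / n)\<close> yields the quadrature point component of \<open>cheb_rule\<close>.
\<close>

definition tent :: "real \<Rightarrow> real"
  where "tent t = 1 - \<bar>2 * t - 1\<bar>"

lemma cos_pi_tent_frac: "cos (pi * tent (frac t)) = cos (2 * pi * t)"
proof -
  have "cos (pi * tent (frac t)) = cos (2 * pi * frac t)"
  proof (cases "frac t \<le> 1/2")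
    case True
    then show ?thesis by (simp add: tent_def algebra_simps)
  next
    case False
    then have "pi * tent (frac t) = 2 * pi - 2 * pi * frac t"
      by (simp add: tent_def algebra_simps)
    then show ?thesis by (simp add: cos_diff)
  qed
  also have "2 * pi * frac t = 2 * pi * t - 2 * pi * of_int \<lfloor>t\<rfloor>"
    by (simp add: frac_def algebra_simps)
  also have "cos \<dots> = cos (2 * pi * t)"
    by (simp add: cos_diff)
  finally show ?thesis .
qed

definition exact_on :: "nat \<Rightarrow> nat list set \<Rightarrow> nat \<Rightarrow> int list \<Rightarrow> bool"
  where "exact_on d \<Lambda> n z \<longleftrightarrow>
    (\<forall>f\<in>cheb_space d \<Lambda>. cheb_rule n z f = (\<integral>x. f x \<partial>cheb_measure d))"

definition sign_changes :: "nat list set \<Rightarrow> int list set"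
  where "sign_changes \<Lambda> =
    {map2 (\<lambda>s m. s * int m) \<sigma> k | \<sigma> k. k \<in> \<Lambda> \<and> length \<sigma> = length k \<and> set \<sigma> \<subseteq> {-1, 1}}"

text \<open>Inserting 0 fixes the value 0 for the empty index set and changes nothing otherwise.\<close>

definition max_component :: "nat list set \<Rightarrow> nat"
  where "max_component \<Lambda> = Max (insert 0 (\<Union>k\<in>\<Lambda>. set k))"

definition dot :: "int list \<Rightarrow> int list \<Rightarrow> int"
  where "dot h z = (\<Sum>j<length z. h ! j * z ! j)"

definition avoids :: "nat \<Rightarrow> int list set \<Rightarrow> int list \<Rightarrow> bool"
  where "avoids n A z \<longleftrightarrow>
    (\<forall>h\<in>A - {replicate (length z) 0}. \<not> [dot h z = 0] (mod int n))"

definition zero_slice :: "nat \<Rightarrow> int list set \<Rightarrow> nat \<Rightarrow> int list set"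
  where "zero_slice d A s = {h. length h = s \<and> h @ replicate (d - s) 0 \<in> A}"

definition shadow :: "nat \<Rightarrow> int list set \<Rightarrow> nat \<Rightarrow> int list set"
  where "shadow d A s = {h. length h = s \<and> (\<exists>g. length g = d - s \<and> h @ g \<in> A)}"

text \<open>
  \<open>P s\<close> is the projection of \<open>A\<close> to the first \<open>s\<close> components. In the step from \<open>s\<close> to \<open>s + 1\<close>
  components the condition on the prefix is void for \<open>s = 0\<close>, since the only vector of length 0
  is the zero vector. The second part records that the construction can be run to its end,
  giving a vector that is good for \<open>A\<close> itself.
\<close>

definition cbc_constructible ::
    "nat \<Rightarrow> nat \<Rightarrow> int list set \<Rightarrow> (nat \<Rightarrow> int list set) \<Rightarrow> bool"
  where "cbc_constructible n d A P \<longleftrightarrow>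
    (\<forall>s<d. \<forall>z. length z = s \<and> set z \<subseteq> {1..int n - 1} \<and> avoids n (P s) z \<longrightarrow>
       (\<exists>y\<in>{1..int n - 1}. avoids n (P (Suc s)) (z @ [y]))) \<and>
    (\<exists>z. length z = d \<and> set z \<subseteq> {1..int n - 1} \<and>
       (\<forall>s\<in>{1..d}. avoids n (P s) (take s z)) \<and> avoids n A z)"

end

theory Submission imports Defs begin

text \<open>
  Both claims reduce to counting indices \<open>h\<close> with \<open>dot h z\<close> divisible by \<open>n\<close>.

  Exactness. Rule and integral are linear, so exactness on the space spanned by the \<open>\<eta>\<^sub>k\<close>, \<open>k \<in> \<Lambda>\<close>, is
  exactness on each \<open>\<eta>\<^sub>k\<close>. The integral of \<open>\<eta>\<^sub>k\<close> is 1 for \<open>k = 0\<close> and 0 otherwise, because the density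
  and the basis are products and the one-dimensional integral is elementary
  (\<open>has_bochner_integral_cheb_basis\<close>). On the other side \<open>T\<^sub>k (cos t) = cos (k t)\<close> turns \<open>\<eta>\<^sub>k\<close> at a node
  into a product of cosines, which is the average of \<open>cos (2 \<pi> i (h \<cdot> z) / n)\<close> over all sign changes
  \<open>h\<close> of \<open>k\<close>. Averaging over the nodes \<open>i\<close> leaves 1 for each \<open>h\<close> with \<open>n dvd h \<cdot> z\<close> and 0 for the others
  (\<open>cheb_rule_basis\<close>). All these contributions are nonnegative, so they cannot cancel: for \<open>k \<noteq> 0\<close> the
  rule gives 0 exactly if no sign change of \<open>k\<close> satisfies the congruence.

  Construction. Suppose a good prefix \<open>z\<close> of length \<open>s\<close> is to be extended by \<open>y\<close>. An index whose last
  component vanishes is harmless, as it comes from an index of the preceding projection. An index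
  with last component \<open>a \<noteq> 0\<close> excludes at most one value \<open>y\<close>, since \<open>\<bar>a\<bar> < n\<close> makes \<open>a\<close>
  invertible modulo the prime \<open>n\<close>. The indices \<open>h\<close> and \<open>- h\<close> exclude the same value, so every
  excluded value uses up two indices, and fewer than \<open>n - 1\<close> values are excluded (\<open>cbc_step\<close>).
\<close>

section \<open>Values of the rule on the Chebyshev basis\<close>

definition sign_vectors :: "nat \<Rightarrow> int list set"
  where "sign_vectors d = {\<sigma>. set \<sigma> \<subseteq> {-1, 1} \<and> length \<sigma> = d}"

lemma finite_sign_vectors: "finite (sign_vectors d)"
  unfolding sign_vectors_def by (rule finite_lists_length_eq) simp

lemma sum_sign_vectors_Suc:
  fixes f :: "int list \<Rightarrow> real"
  shows "(\<Sum>\<sigma>\<in>sign_vectors (Suc d). f \<sigma>) = (\<Sum>\<sigma>\<in>sign_vectors d. f (1 # \<sigma>) + f (-1 # \<sigma>))"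
proof -
  have eq: "sign_vectors (Suc d) = (#) 1 ` sign_vectors d \<union> (#) (-1) ` sign_vectors d"
    by (auto simp: sign_vectors_def length_Suc_conv)
  have "(\<Sum>\<sigma>\<in>sign_vectors (Suc d). f \<sigma>) =
      (\<Sum>\<sigma>\<in>(#) 1 ` sign_vectors d. f \<sigma>) + (\<Sum>\<sigma>\<in>(#) (-1) ` sign_vectors d. f \<sigma>)"
    unfolding eq by (rule sum.union_disjoint) (auto simp: finite_sign_vectors)
  then show ?thesis
    by (simp add: sum.reindex inj_on_def sum.distrib)
qed

text \<open>Iterating \<open>2 cos a cos b = cos (a + b) + cos (- a + b)\<close>.\<close>

lemma prod_cos_eq_sum_signs:
  "(\<Prod>j<d. cos (\<theta> j)) =
    (1 / 2 ^ d) * (\<Sum>\<sigma>\<in>sign_vectors d. cos (\<Sum>j<d. real_of_int (\<sigma> ! j) * \<theta> j))"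
proof (induction d arbitrary: \<theta>)
  case 0
  have "sign_vectors 0 = {[]}" by (auto simp: sign_vectors_def)
  then show ?case by simp
next
  case (Suc d)
  let ?S = "\<lambda>\<sigma>. \<Sum>j<d. real_of_int (\<sigma> ! j) * \<theta> (Suc j)"
  have "(\<Prod>j<Suc d. cos (\<theta> j)) = cos (\<theta> 0) * (\<Prod>j<d. cos (\<theta> (Suc j)))"
    by (rule prod.lessThan_Suc_shift)
  also have "\<dots> = (1 / 2 ^ Suc d) * (\<Sum>\<sigma>\<in>sign_vectors d. 2 * (cos (\<theta> 0) * cos (?S \<sigma>)))"
    by (simp add: Suc.IH[of "\<lambda>j. \<theta> (Suc j)"] sum_distrib_left mult_ac)
  also have "(\<Sum>\<sigma>\<in>sign_vectors d. 2 * (cos (\<theta> 0) * cos (?S \<sigma>))) =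
      (\<Sum>\<sigma>\<in>sign_vectors d. cos (\<theta> 0 + ?S \<sigma>) + cos (- \<theta> 0 + ?S \<sigma>))"
    by (rule sum.cong) (simp_all add: cos_add cos_diff)
  also have "\<dots> = (\<Sum>\<sigma>\<in>sign_vectors (Suc d). cos (\<Sum>j<Suc d. real_of_int (\<sigma> ! j) * \<theta> j))"
    unfolding sum_sign_vectors_Suc sum.lessThan_Suc_shift by simp
  finally show ?case .
qed

text \<open>
  The character sum behind every lattice rule. If \<open>n\<close> does not divide \<open>m\<close>, multiplication by
  \<open>2 sin (\<pi> m / n) \<noteq> 0\<close> makes the sum telescope, and the two end terms cancel by periodicity.
\<close>

lemma sum_cos_equidistant:
  fixes m :: int
  assumes "n > 0"
  shows "(\<Sum>i<n. cos (2 * pi * real i * real_of_int m / real n)) =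
    (if [m = 0] (mod int n) then real n else 0)"
proof (cases "[m = 0] (mod int n)")
  case True
  then obtain q where q: "m = int n * q" by (auto simp: cong_0_iff)
  have "cos (2 * pi * real i * real_of_int m / real n) = 1" for i
  proof -
    have "2 * pi * real i * real_of_int m / real n = 2 * pi * of_int (int i * q)"
      using assms by (simp add: q)
    then show ?thesis by (metis cos_int_2pin)
  qed
  then show ?thesis using True by simp
next
  case False
  define a where "a = 2 * pi * real_of_int m / real n"
  have na: "real n * a = 2 * pi * real_of_int m" using assms by (simp add: a_def)
  have "sin (a / 2) \<noteq> 0"
  proof
    assume "sin (a / 2) = 0"
    then obtain q :: int where "a / 2 = of_int q * pi" by (auto simp: sin_zero_iff_int2)
    then have "real_of_int m = real_of_int (q * int n)"
      using assms by (simp add: a_def field_simps)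
    then have "m = q * int n" using of_int_eq_iff by blast
    with False show False by (simp add: cong_0_iff)
  qed
  moreover have tel: "2 * sin (a / 2) * (\<Sum>i<k. cos (real i * a)) =
      sin (real k * a - a / 2) + sin (a / 2)" for k
  proof (induction k)
    case (Suc k)
    have "sin (real (Suc k) * a - a / 2) - sin (real k * a - a / 2) =
        sin (real k * a + a / 2) - sin (real k * a - a / 2)"
      by (simp add: algebra_simps)
    also have "\<dots> = 2 * sin (a / 2) * cos (real k * a)"
      by (simp add: sin_add sin_diff)
    finally show ?case using Suc by (simp add: distrib_left)
  qed simp
  have "sin (real n * a - a / 2) = - sin (a / 2)"
    unfolding na sin_diff by simp
  with tel[of n] have "2 * sin (a / 2) * (\<Sum>i<n. cos (real i * a)) = 0" by simp
  ultimately have "(\<Sum>i<n. cos (real i * a)) = 0" by simp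
  then show ?thesis using False by (simp add: a_def mult_ac)
qed

text \<open>
  As \<open>t\<close> need not lie in \<open>{0..pi}\<close>, \<open>arccos (cos t)\<close> is \<open>t\<close> only up to sign and multiples of
  \<open>2 * pi\<close>; the factor \<open>k\<close> preserves both ambiguities and cosine ignores them.
\<close>

lemma cheb_T_cos: "cheb_T k (cos t) = cos (real k * t)"
proof -
  have "cos (arccos (cos t)) = cos t" by (simp add: cos_arccos)
  then obtain r where "r \<in> \<int>"
    "arccos (cos t) = t + 2 * r * pi \<or> arccos (cos t) = - t + 2 * r * pi"
    unfolding cos_eq by blast
  then obtain m :: int where
    "arccos (cos t) = t + 2 * of_int m * pi \<or> arccos (cos t) = - t + 2 * of_int m * pi"
    by (metis Ints_cases)
  then have "real k * arccos (cos t) = real k * t + 2 * pi * of_int (int k * m) \<or>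
      real k * arccos (cos t) = - (real k * t) + 2 * pi * of_int (int k * m)"
    by (elim disjE) (simp_all add: distrib_left right_diff_distrib mult_ac)
  then show ?thesis
    unfolding cheb_T_def
    by (elim disjE) (simp_all only: cos_add cos_int_2pin sin_int_2pin, simp_all)
qed

abbreviation signed :: "int list \<Rightarrow> nat list \<Rightarrow> int list"
  where "signed \<sigma> k \<equiv> map2 (\<lambda>s m. s * int m) \<sigma> k"

text \<open>
  The value is a positive multiple of a cardinality, hence it vanishes only if every single sign
  change violates the congruence.
\<close>

lemma cheb_rule_basis:
  assumes "length k = d" "length z = d" "n > 0"
  shows "cheb_rule n z (cheb_basis k) = sqrt 2 ^ num_nonzero k / 2 ^ d *
    real (card {\<sigma>\<in>sign_vectors d. [dot (signed \<sigma> k) z = 0] (mod int n)})"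
proof -
  let ?\<theta> = "\<lambda>i j. real (k ! j) * (2 * pi * real i * real_of_int (z ! j) / real n)"
  have basis: "cheb_basis k (\<lambda>j\<in>{..<length z}. cos (2 * pi * real i * real_of_int (z ! j) / real n))
      = sqrt 2 ^ num_nonzero k / 2 ^ d *
        (\<Sum>\<sigma>\<in>sign_vectors d. cos (2 * pi * real i * real_of_int (dot (signed \<sigma> k) z) / real n))" for i
  proof -
    have "(\<Sum>j<d. real_of_int (\<sigma> ! j) * ?\<theta> i j) =
        2 * pi * real i * real_of_int (dot (signed \<sigma> k) z) / real n"
      if "\<sigma> \<in> sign_vectors d" for \<sigma>
    proof -
      have "length \<sigma> = d" using that by (simp add: sign_vectors_def)
      then show ?thesis
        using assms unfolding dot_def
        by (simp add: sum_distrib_left sum_divide_distrib mult_ac)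
    qed
    then have "(\<Prod>j<d. cos (?\<theta> i j)) = (1 / 2 ^ d) *
        (\<Sum>\<sigma>\<in>sign_vectors d. cos (2 * pi * real i * real_of_int (dot (signed \<sigma> k) z) / real n))"
      unfolding prod_cos_eq_sum_signs by simp
    then show ?thesis
      using assms by (simp add: cheb_basis_def cheb_T_cos)
  qed
  have "cheb_rule n z (cheb_basis k) = (1 / real n) * (sqrt 2 ^ num_nonzero k / 2 ^ d *
      (\<Sum>\<sigma>\<in>sign_vectors d. \<Sum>i<n. cos (2 * pi * real i * real_of_int (dot (signed \<sigma> k) z) / real n)))"
    unfolding cheb_rule_def basis sum_distrib_left[symmetric]
    by (subst sum.swap) simp
  also have "\<dots> = sqrt 2 ^ num_nonzero k / 2 ^ d *
      (\<Sum>\<sigma>\<in>sign_vectors d. if [dot (signed \<sigma> k) z = 0] (mod int n) then 1 else 0)"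
    using assms(3)
    by (simp add: sum_cos_equidistant sum_distrib_left if_distrib cong: if_cong)
  also have "(\<Sum>\<sigma>\<in>sign_vectors d. if [dot (signed \<sigma> k) z = 0] (mod int n) then 1 else 0) =
      real (card {\<sigma>\<in>sign_vectors d. [dot (signed \<sigma> k) z = 0] (mod int n)})"
    by (simp add: sum.If_cases finite_sign_vectors Int_def)
  finally show ?thesis .
qed

section \<open>Integrals of the Chebyshev basis\<close>

lemma borel_measurable_cheb_T:
  "(\<lambda>x. indicator {-1..1} x * cheb_T k x) \<in> borel_measurable borel"
proof -
  have "continuous_on {-1..1} (cheb_T k)"
    unfolding cheb_T_def by (intro continuous_intros) auto
  then have "(\<lambda>x. indicator {-1..1} x *\<^sub>R cheb_T k x) \<in> borel_measurable borel"
    by (intro borel_measurable_continuous_on_indicator) auto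
  then show ?thesis by simp
qed

text \<open>
  The substitution \<open>x = cos t\<close> suggests the antiderivative \<open>- sin (k arccos x) / (k \<pi>)\<close>, and
  \<open>- arccos x / \<pi>\<close> for \<open>k = 0\<close>. It is continuous on the closed interval, so the gauge integral needs
  the derivative in the interior only and the poles of the density at the endpoints do no harm.
\<close>

lemma has_integral_cheb_T:
  "((\<lambda>x. cheb_T k x / (pi * sqrt (1 - x\<^sup>2))) has_integral (if k = 0 then 1 else 0)) {-1..1}"
proof -
  define F where "F x = (if k = 0 then - arccos x / pi else - sin (real k * arccos x) / (real k * pi))"
    for x
  have "((\<lambda>x. cheb_T k x / (pi * sqrt (1 - x\<^sup>2))) has_integral (F 1 - F (-1))) {-1..1}"
  proof (rule fundamental_theorem_of_calculus_interior)
    show "continuous_on {-1..1} F"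
      unfolding F_def by (cases "k = 0") (auto intro!: continuous_intros)
  next
    fix x :: real assume x: "x \<in> {-1<..<1}"
    then have "x\<^sup>2 < 1" by (simp add: abs_square_less_1 abs_less_iff)
    then have "sqrt (1 - x\<^sup>2) > 0" by simp
    then have "(F has_real_derivative cheb_T k x / (pi * sqrt (1 - x\<^sup>2))) (at x)"
      unfolding F_def cheb_T_def
      using x by (cases "k = 0") (auto intro!: derivative_eq_intros simp: field_simps)
    then show "(F has_vector_derivative cheb_T k x / (pi * sqrt (1 - x\<^sup>2))) (at x)"
      by (rule has_real_derivative_iff_has_vector_derivative[THEN iffD1])
  qed simp
  moreover have "F 1 - F (-1) = (if k = 0 then 1 else 0)"
    by (simp add: F_def)
  ultimately show ?thesis by simp
qed

text \<open>
  The product formula for integrals requires Lebesgue integrability. For \<open>k = 0\<close> it follows from the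
  gauge integral because the integrand is nonnegative, and \<open>\<bar>T\<^sub>k\<bar> \<le> 1\<close> transfers it to all \<open>k\<close>.
\<close>

lemma has_bochner_integral_cheb_T:
  "has_bochner_integral lborel
    (\<lambda>x. indicator {-1..1} x * cheb_T k x * (1 / (pi * sqrt (1 - x\<^sup>2)))) (if k = 0 then 1 else 0)"
proof -
  let ?w = "\<lambda>x::real. 1 / (pi * sqrt (1 - x\<^sup>2))"
  let ?g = "\<lambda>k x. indicator {-1..1} x * cheb_T k x * ?w x"
  have meas: "?g k \<in> borel_measurable lborel" for k
    using borel_measurable_cheb_T[of k] by measurable
  have nonneg: "0 \<le> ?w x" if "x \<in> {-1..1}" for x
    using that by (simp add: abs_square_le_1 abs_le_iff)
  have "(\<lambda>x. cheb_T 0 x / (pi * sqrt (1 - x\<^sup>2))) absolutely_integrable_on {-1..1}"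
    by (rule nonnegative_absolutely_integrable_1)
       (use has_integral_cheb_T[of 0] nonneg in \<open>auto simp: cheb_T_def integrable_on_def\<close>)
  then have "integrable lebesgue (?g 0)"
    by (simp add: set_integrable_def mult_ac)
  then have int0: "integrable lborel (?g 0)"
    using meas by (simp add: integrable_completion)
  have int: "integrable lborel (?g k)"
  proof (rule Bochner_Integration.integrable_bound[OF int0 meas], rule AE_I2)
    fix x :: real
    have "\<bar>cheb_T k x\<bar> * \<bar>?w x\<bar> \<le> 1 * \<bar>?w x\<bar>"
      by (intro mult_right_mono) (simp_all add: cheb_T_def)
    then show "norm (?g k x) \<le> norm (?g 0 x)"
      by (auto simp: cheb_T_def abs_mult indicator_def)
  qed
  have lebesgue: "(?g k has_integral integral\<^sup>L lborel (?g k)) UNIV"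
    using int by (rule has_integral_integral_lborel)
  have "((\<lambda>x. if x \<in> {-1..1} then cheb_T k x / (pi * sqrt (1 - x\<^sup>2)) else 0)
      has_integral (if k = 0 then 1 else 0)) UNIV"
    using has_integral_cheb_T[of k] by (subst has_integral_restrict_UNIV)
  moreover have "(\<lambda>x. if x \<in> {-1..1} then cheb_T k x / (pi * sqrt (1 - x\<^sup>2)) else 0) = ?g k"
    by (auto simp: indicator_def fun_eq_iff)
  ultimately have "(?g k has_integral (if k = 0 then 1 else 0)) UNIV"
    by simp
  with lebesgue have "integral\<^sup>L lborel (?g k) = (if k = 0 then 1 else 0)"
    by (rule has_integral_unique)
  with int show ?thesis by (simp add: has_bochner_integral_iff)
qed

lemma space_cheb_measure: "space (cheb_measure d) = cheb_cube d"
  by (auto simp: cheb_measure_def space_restrict_space space_PiM cheb_cube_def)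

text \<open>
  The indicator of the cube is split into one factor per coordinate, so that the integral becomes a
  product of one-dimensional integrals, one of which vanishes unless \<open>k = 0\<close>.
\<close>

lemma has_bochner_integral_cheb_basis:
  assumes "length k = d"
  shows "has_bochner_integral (cheb_measure d) (cheb_basis k) (if k = replicate d 0 then 1 else 0)"
proof -
  interpret product_sigma_finite "\<lambda>_::nat. lborel :: real measure"
    by standard
  let ?L = "\<Pi>\<^sub>M j\<in>{..<d}. lborel :: real measure"
  let ?w = "\<lambda>x::real. 1 / (pi * sqrt (1 - x\<^sup>2))"
  let ?g = "\<lambda>j x. indicator {-1..1} x * cheb_T (k ! j) x"
  let ?c = "sqrt 2 ^ num_nonzero k :: real"
  \<comment> \<open>The cut-off version of the basis function: measurable everywhere whatever the value of
    \<open>arccos\<close> outside \<open>{-1..1}\<close>, and equal to the basis function on the cube.\<close>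
  define f where "f x = ?c * (\<Prod>j<d. ?g j (x j))" for x :: "nat \<Rightarrow> real"
  define W where "W x = 1 / (\<Prod>j<d. pi * sqrt (1 - (x j)\<^sup>2))" for x :: "nat \<Rightarrow> real"
  have g: "?g j \<in> borel_measurable lborel" for j
    using borel_measurable_cheb_T[of "k ! j"] by simp
  have "(\<lambda>x. ?g j (x j)) \<in> borel_measurable ?L" if "j < d" for j
    by (rule measurable_compose[OF _ g, of "\<lambda>x. x j"], rule measurable_component_singleton)
       (use that in simp)
  then have "(\<lambda>x. \<Prod>j<d. ?g j (x j)) \<in> borel_measurable ?L"
    by (intro borel_measurable_prod) simp
  then have f_meas: "f \<in> borel_measurable ?L"
    unfolding f_def by measurable
  have W_meas: "W \<in> borel_measurable ?L"
    unfolding W_def by measurable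
  have cube: "cheb_cube d \<in> sets ?L"
    unfolding cheb_cube_def by (rule sets_PiM_I_finite) auto
  have eq: "cheb_basis k x = f x" if "x \<in> cheb_cube d" for x
    using that assms by (auto simp: f_def cheb_basis_def cheb_cube_def PiE_iff intro!: prod.cong)
  have integrand: "indicator (cheb_cube d) x * (W x * f x) =
      ?c * (\<Prod>j<d. ?g j (x j) * ?w (x j))" if "x \<in> space ?L" for x
  proof (cases "x \<in> cheb_cube d")
    case True
    then show ?thesis
      by (simp add: W_def f_def prod.distrib prod_dividef)
  next
    case False
    with that obtain j where "j < d" "x j \<notin> {-1..1}"
      by (auto simp: cheb_cube_def space_PiM PiE_iff)
    then have "(\<Prod>j<d. ?g j (x j) * ?w (x j)) = 0"
      by (intro prod_zero) (auto intro!: bexI[of _ j])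
    with False show ?thesis by simp
  qed
  have one: "integrable lborel (\<lambda>x. ?g j x * ?w x)"
    "(\<integral>x. ?g j x * ?w x \<partial>lborel) = (if k ! j = 0 then 1 else 0)" for j
    using has_bochner_integral_cheb_T[of "k ! j"] by (auto simp: has_bochner_integral_iff)
  have "has_bochner_integral ?L (\<lambda>x. ?c * (\<Prod>j<d. ?g j (x j) * ?w (x j)))
      (?c * (\<Prod>j<d. if k ! j = 0 then 1 else 0))"
    unfolding one(2)[symmetric]
    by (intro has_bochner_integral_mult_right)
       (simp only: has_bochner_integral_iff product_integrable_prod[OF _ one(1)]
          product_integral_prod[OF _ one(1)] finite_lessThan simp_thms)
  also have "?c * (\<Prod>j<d. if k ! j = 0 then 1 else 0) = (if k = replicate d 0 then 1 else 0)"
  proof (cases "k = replicate d 0")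
    case True
    then have "{j. j < length k \<and> k ! j \<noteq> 0} = {}" by auto
    then have "num_nonzero k = 0" by (simp only: num_nonzero_def card.empty)
    then show ?thesis using True by simp
  next
    case False
    then obtain j where "j < d" "k ! j \<noteq> 0"
      using assms by (auto simp: list_eq_iff_nth_eq)
    then have "(\<Prod>j<d. if k ! j = 0 then 1 else 0 :: real) = 0"
      by (intro prod_zero) auto
    with False show ?thesis by simp
  qed
  finally have "has_bochner_integral ?L (\<lambda>x. indicator (cheb_cube d) x *\<^sub>R (W x *\<^sub>R f x))
      (if k = replicate d 0 then 1 else 0)"
    by (subst has_bochner_integral_cong[OF refl _ refl]) (simp_all only: real_scaleR_def integrand)
  then have "has_bochner_integral (restrict_space ?L (cheb_cube d)) (\<lambda>x. W x *\<^sub>R f x)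
      (if k = replicate d 0 then 1 else 0)"
    by (subst has_bochner_integral_restrict_space) (use cube in auto)
  then have "has_bochner_integral (cheb_measure d) f (if k = replicate d 0 then 1 else 0)"
    unfolding cheb_measure_def W_def[symmetric]
  proof (rule has_bochner_integral_density[rotated 3])
    show "AE x in restrict_space ?L (cheb_cube d). 0 \<le> W x"
      by (rule AE_I2)
         (auto simp: W_def space_restrict_space cheb_cube_def PiE_iff abs_square_le_1 abs_le_iff intro!: prod_nonneg)
  qed (auto intro: measurable_restrict_space1 f_meas W_meas)
  then show ?thesis
    by (subst has_bochner_integral_cong[OF refl eq refl]) (simp_all add: space_cheb_measure)
qed

section \<open>Exactness of the rule\<close>

text \<open>Linearity of rule and integral in one direction, unit coefficient vectors in the other.\<close>

lemma exact_on_iff_basis: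
  assumes "finite \<Lambda>" "\<forall>k\<in>\<Lambda>. length k = d" "length z = d"
  shows "exact_on d \<Lambda> n z \<longleftrightarrow>
    (\<forall>k\<in>\<Lambda>. cheb_rule n z (cheb_basis k) = (if k = replicate d 0 then 1 else 0))"
proof
  assume ex: "exact_on d \<Lambda> n z"
  show "\<forall>k\<in>\<Lambda>. cheb_rule n z (cheb_basis k) = (if k = replicate d 0 then 1 else 0)"
  proof
    fix k assume k: "k \<in> \<Lambda>"
    have "cheb_basis k x = (\<Sum>l\<in>\<Lambda>. (if l = k then 1 else 0) * cheb_basis l x)" for x
      using k sum.delta[OF assms(1), of k "\<lambda>l. cheb_basis l x"]
      by (simp add: if_distrib[of "\<lambda>a. a * _"] cong: if_cong)
    then have "cheb_basis k \<in> cheb_space d \<Lambda>"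
      unfolding cheb_space_def
      by (intro CollectI exI[of _ "\<lambda>l. if l = k then 1 else 0"]) simp
    with ex have "cheb_rule n z (cheb_basis k) = (\<integral>x. cheb_basis k x \<partial>cheb_measure d)"
      by (auto simp: exact_on_def)
    also have "\<dots> = (if k = replicate d 0 then 1 else 0)"
      using assms(2) k
      by (intro has_bochner_integral_integral_eq has_bochner_integral_cheb_basis) blast
    finally show "cheb_rule n z (cheb_basis k) = (if k = replicate d 0 then 1 else 0)" .
  qed
next
  assume basis: "\<forall>k\<in>\<Lambda>. cheb_rule n z (cheb_basis k) = (if k = replicate d 0 then 1 else 0)"
  show "exact_on d \<Lambda> n z"
    unfolding exact_on_def
  proof
    fix f assume "f \<in> cheb_space d \<Lambda>"
    then obtain c where c: "\<And>x. x \<in> cheb_cube d \<Longrightarrow> f x = (\<Sum>k\<in>\<Lambda>. c k * cheb_basis k x)"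
      by (auto simp: cheb_space_def)
    let ?p = "\<lambda>i. \<lambda>j\<in>{..<length z}. cos (2 * pi * real i * real_of_int (z ! j) / real n)"
    have "?p i \<in> cheb_cube d" for i
      using assms(3) by (auto simp: cheb_cube_def)
    then have "cheb_rule n z f = (1 / real n) * (\<Sum>i<n. \<Sum>k\<in>\<Lambda>. c k * cheb_basis k (?p i))"
      by (simp add: cheb_rule_def c)
    also have "\<dots> = (\<Sum>k\<in>\<Lambda>. c k * cheb_rule n z (cheb_basis k))"
      by (subst sum.swap) (simp add: cheb_rule_def sum_distrib_left mult_ac)
    also have "\<dots> = (\<Sum>k\<in>\<Lambda>. c k * (if k = replicate d 0 then 1 else 0))"
      using basis by simp
    also have "\<dots> = (\<integral>x. (\<Sum>k\<in>\<Lambda>. c k * cheb_basis k x) \<partial>cheb_measure d)"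
      by (rule has_bochner_integral_integral_eq[symmetric])
         (intro has_bochner_integral_sum has_bochner_integral_mult_right
            has_bochner_integral_cheb_basis; use assms(2) in blast)
    also have "\<dots> = (\<integral>x. f x \<partial>cheb_measure d)"
      by (rule Bochner_Integration.integral_cong) (simp_all add: c space_cheb_measure)
    finally show "cheb_rule n z f = (\<integral>x. f x \<partial>cheb_measure d)" .
  qed
qed

lemma signed_eq_zero_iff:
  assumes "\<sigma> \<in> sign_vectors d" "length k = d"
  shows "signed \<sigma> k = replicate d 0 \<longleftrightarrow> k = replicate d 0"
proof -
  have "\<sigma> ! j \<noteq> 0" if "j < d" for j
  proof -
    have "\<sigma> ! j \<in> set \<sigma>" using assms(1) that by (simp add: sign_vectors_def)
    then show ?thesis using assms(1) by (auto simp: sign_vectors_def)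
  qed
  with assms show ?thesis
    by (auto simp: list_eq_iff_nth_eq sign_vectors_def)
qed

lemma sign_changes_eq:
  assumes "\<forall>k\<in>\<Lambda>. length k = d"
  shows "sign_changes \<Lambda> = (\<Union>k\<in>\<Lambda>. (\<lambda>\<sigma>. signed \<sigma> k) ` sign_vectors d)"
  using assms by (fastforce simp: sign_changes_def sign_vectors_def)

text \<open>
  An index \<open>k \<noteq> 0\<close> requires that the count in \<open>cheb_rule_basis\<close> be 0. The index \<open>k = 0\<close> imposes no
  condition on either side: constants are always integrated exactly, and all sign changes of 0
  coincide with 0, which is excluded.
\<close>

lemma exact_on_iff:
  assumes "n > 0" "finite \<Lambda>" "\<forall>k\<in>\<Lambda>. length k = d" "length z = d"
  shows "exact_on d \<Lambda> n z \<longleftrightarrow>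
    (\<forall>h\<in>sign_changes \<Lambda> - {replicate d 0}. \<not> [dot h z = 0] (mod int n))"
proof -
  have "cheb_rule n z (cheb_basis k) = (if k = replicate d 0 then 1 else 0) \<longleftrightarrow>
      (\<forall>\<sigma>\<in>sign_vectors d. signed \<sigma> k \<noteq> replicate d 0 \<longrightarrow> \<not> [dot (signed \<sigma> k) z = 0] (mod int n))"
    if "k \<in> \<Lambda>" for k
  proof -
    have k: "length k = d" using that assms(3) by auto
    show ?thesis
    proof (cases "k = replicate d 0")
      case True
      have "cheb_basis k x = 1" for x
        by (simp add: True cheb_basis_def num_nonzero_def cheb_T_def cong: conj_cong)
      then show ?thesis using True assms(1) k
        by (simp add: cheb_rule_def signed_eq_zero_iff)
    next
      case False
      then show ?thesis
        using cheb_rule_basis[OF k assms(4,1)]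
        by (auto simp: signed_eq_zero_iff k finite_sign_vectors)
    qed
  qed
  then show ?thesis
    unfolding exact_on_iff_basis[OF assms(2-4)] sign_changes_eq[OF assms(3)] by auto
qed

section \<open>Component-by-component construction\<close>

lemma dot_snoc:
  assumes "length h = length z"
  shows "dot (h @ [a]) (z @ [y]) = dot h z + a * y"
  using assms by (simp add: dot_def nth_append)

lemma dot_uminus:
  assumes "length z \<le> length h"
  shows "dot (map uminus h) z = - dot h z"
  using assms by (simp add: dot_def sum_negf)

lemma unique_blocked_value:
  fixes a c y y' :: int
  assumes "prime n" "a \<noteq> 0" "\<bar>a\<bar> < int n"
    and "y \<in> {1..int n - 1}" "y' \<in> {1..int n - 1}"
    and "[c + a * y = 0] (mod int n)" "[c + a * y' = 0] (mod int n)"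
  shows "y = y'"
proof -
  have "\<not> int n dvd a"
    using assms(2,3) zdvd_imp_le[of "int n" "\<bar>a\<bar>"] by auto
  then have "coprime a (int n)"
    using assms(1) by (metis prime_imp_coprime prime_int_nat_transfer coprime_commute prime_nat_int_transfer)
  moreover have "[a * y = a * y'] (mod int n)"
    using assms(6,7) by (metis cong_add_lcancel cong_sym cong_trans)
  ultimately have "[y = y'] (mod int n)"
    by (simp add: cong_mult_lcancel)
  with assms(4,5) show ?thesis
    by (intro cong_less_imp_eq_int[of y "int n" y']) auto
qed

text \<open>
  The counting argument takes place in \<open>A\<close> itself. For every value \<open>y\<close>, \<open>B y\<close> collects the indices of
  \<open>A\<close> whose truncation after component \<open>s\<close> excludes \<open>y\<close> and does not end in 0. The sets \<open>B y\<close> are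
  disjoint, and an excluded \<open>y\<close> puts some \<open>g\<close> and \<open>- g\<close> into \<open>B y\<close>. If all \<open>n - 1\<close> values were excluded,
  \<open>A\<close> would have at least \<open>2 * (n - 1)\<close> nonzero elements. Of the projections the argument uses only that they
  consist of truncations of \<open>A\<close> and that deleting a final 0 leads into the preceding one; it therefore
  covers both kinds of projection at once.
\<close>

lemma cbc_step:
  assumes "prime n" "finite A" and len: "\<forall>h\<in>A. length h = d"
    and sym: "\<forall>h\<in>A. map uminus h \<in> A"
    and small: "\<forall>h\<in>A. \<forall>a\<in>set h. \<bar>a\<bar> < int n"
    and card: "card (A - {replicate d 0}) < 2 * (n - 1)"
    and P: "\<And>s. s \<le> d \<Longrightarrow> P s \<subseteq> take s ` A"
    and drop: "\<And>s h. s < d \<Longrightarrow> h @ [0] \<in> P (Suc s) \<Longrightarrow> h \<in> P s"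
    and "s < d" "length z = s" and av: "avoids n (P s) z"
  shows "\<exists>y\<in>{1..int n - 1}. avoids n (P (Suc s)) (z @ [y])"
proof (rule ccontr)
  assume none: "\<not> ?thesis"
  let ?Y = "{1..int n - 1}"
  define B where "B y = {g\<in>A. g ! s \<noteq> 0 \<and> [dot (take s g) z + g ! s * y = 0] (mod int n)}" for y
  have finB: "finite (B y)" for y using \<open>finite A\<close> by (simp add: B_def)
  have take_dot: "dot (take (Suc s) g) (z @ [y]) = dot (take s g) z + g ! s * y" if "g \<in> A" for g y
    using that len \<open>s < d\<close> \<open>length z = s\<close> by (simp add: take_Suc_conv_app_nth dot_snoc)
  have two: "2 \<le> card (B y)" if y: "y \<in> ?Y" for y
  proof -
    from none y obtain h where h: "h \<in> P (Suc s)" "h \<noteq> replicate (Suc s) 0"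
      "[dot h (z @ [y]) = 0] (mod int n)"
      using \<open>length z = s\<close> unfolding avoids_def by fastforce
    then obtain g where g: "g \<in> A" "h = take (Suc s) g"
      using P[of "Suc s"] \<open>s < d\<close> by auto
    have h_eq: "h = take s g @ [g ! s]"
      using g len \<open>s < d\<close> by (simp add: take_Suc_conv_app_nth)
    \<comment> \<open>Otherwise \<open>h\<close> without its final 0 would already violate the condition on \<open>z\<close>.\<close>
    have "g ! s \<noteq> 0"
    proof
      assume 0: "g ! s = 0"
      with h h_eq drop \<open>s < d\<close> have "take s g \<in> P s" by simp
      moreover have "take s g \<noteq> replicate s 0"
        using h(2) h_eq 0 by (simp add: replicate_append_same[symmetric])
      moreover have "[dot (take s g) z = 0] (mod int n)"
        using h(3) take_dot[OF g(1)] g(2) 0 by simp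
      ultimately show False using av \<open>length z = s\<close> by (auto simp: avoids_def)
    qed
    then have gB: "g \<in> B y" using h(3) take_dot[OF g(1)] g by (simp add: B_def)
    have lg: "length g = d" using len g(1) by auto
    have "dot (take s (map uminus g)) z + map uminus g ! s * y = - (dot (take s g) z + g ! s * y)"
      using lg \<open>s < d\<close> \<open>length z = s\<close> by (simp add: take_map dot_uminus)
    then have "map uminus g \<in> B y"
      using gB sym lg \<open>s < d\<close> unfolding B_def cong_0_iff
      by (simp only: mem_Collect_eq dvd_minus_iff) simp
    moreover have "map uminus g \<noteq> g"
    proof
      assume "map uminus g = g"
      then have "map uminus g ! s = g ! s" by simp
      with \<open>g ! s \<noteq> 0\<close> lg \<open>s < d\<close> show False by simp
    qed
    ultimately have "card {g, map uminus g} = 2" "{g, map uminus g} \<subseteq> B y" using gB by auto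
    then show ?thesis using card_mono[OF finB] by metis
  qed
  have disj: "B y \<inter> B y' = {}" if "y \<in> ?Y" "y' \<in> ?Y" "y \<noteq> y'" for y y'
  proof -
    have "\<bar>g ! s\<bar> < int n" if "g \<in> A" for g
      using that small len \<open>s < d\<close> by auto
    with unique_blocked_value[OF \<open>prime n\<close> _ _ that(1,2)] that(3) show ?thesis
      by (fastforce simp: B_def)
  qed
  have "2 * (n - 1) = (\<Sum>y\<in>?Y. 2)" by simp
  also have "\<dots> \<le> (\<Sum>y\<in>?Y. card (B y))" using two by (rule sum_mono)
  also have "\<dots> = card (\<Union>y\<in>?Y. B y)"
    using finB disj by (intro card_UN_disjoint[symmetric]) auto
  also have "\<dots> \<le> card (A - {replicate d 0})"
    using \<open>finite A\<close> \<open>s < d\<close> by (intro card_mono) (auto simp: B_def)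
  finally show False using card by simp
qed

lemma cbc_constructibleI:
  assumes "prime n" "finite A" and len: "\<forall>h\<in>A. length h = d"
    and "\<forall>h\<in>A. map uminus h \<in> A"
    and "\<forall>h\<in>A. \<forall>a\<in>set h. \<bar>a\<bar> < int n"
    and "card (A - {replicate d 0}) < 2 * (n - 1)"
    and P: "\<And>s. s \<le> d \<Longrightarrow> P s \<subseteq> take s ` A"
    and "\<And>s h. s < d \<Longrightarrow> h @ [0] \<in> P (Suc s) \<Longrightarrow> h \<in> P s"
    and "A \<subseteq> P d"
  shows "cbc_constructible n d A P"
proof -
  have step: "\<exists>y\<in>{1..int n - 1}. avoids n (P (Suc s)) (z @ [y])"
    if "s < d" "length z = s" "avoids n (P s) z" for s z
    using cbc_step[of n A d P s z] assms that by blast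
  \<comment> \<open>The only list of length 0 is the zero vector, so the empty prefix is always good.\<close>
  have P0: "avoids n (P 0) []"
    using P[of 0] by (auto simp: avoids_def)
  have "\<exists>z. length z = s \<and> set z \<subseteq> {1..int n - 1} \<and> (\<forall>t\<le>s. avoids n (P t) (take t z))"
    if "s \<le> d" for s
    using that
  proof (induction s)
    case 0
    then show ?case using P0 by simp
  next
    case (Suc s)
    then obtain z where z: "length z = s" "set z \<subseteq> {1..int n - 1}"
      "\<forall>t\<le>s. avoids n (P t) (take t z)" by auto
    then have "avoids n (P s) z" by (metis order_refl take_all)
    with step[of s z] z(1) Suc.prems obtain y where
      "y \<in> {1..int n - 1}" "avoids n (P (Suc s)) (z @ [y])" by (meson Suc_le_eq)
    with z show ?case
      by (intro exI[of _ "z @ [y]"]) (auto simp: le_Suc_eq)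
  qed
  from this[of d] obtain z where z: "length z = d" "set z \<subseteq> {1..int n - 1}"
    "\<forall>t\<le>d. avoids n (P t) (take t z)" by auto
  then have "avoids n (P d) z" by (metis order_refl take_all)
  then have "avoids n A z" using \<open>A \<subseteq> P d\<close> by (auto simp: avoids_def)
  with z step show ?thesis
    unfolding cbc_constructible_def by auto
qed

lemma cbc_constructible_zero_slice:
  assumes "prime n" "finite A" and len: "\<forall>h\<in>A. length h = d"
    and "\<forall>h\<in>A. map uminus h \<in> A"
    and "\<forall>h\<in>A. \<forall>a\<in>set h. \<bar>a\<bar> < int n"
    and "card (A - {replicate d 0}) < 2 * (n - 1)"
  shows "cbc_constructible n d A (zero_slice d A)"
proof (rule cbc_constructibleI[OF assms])
  show "zero_slice d A s \<subseteq> take s ` A" for s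
    by (force simp: zero_slice_def)
  show "h \<in> zero_slice d A s" if "s < d" "h @ [0] \<in> zero_slice d A (Suc s)" for s h
    using that by (simp add: zero_slice_def Suc_diff_Suc[symmetric])
  show "A \<subseteq> zero_slice d A d"
    using len by (auto simp: zero_slice_def)
qed

lemma cbc_constructible_shadow:
  assumes "prime n" "finite A" and len: "\<forall>h\<in>A. length h = d"
    and "\<forall>h\<in>A. map uminus h \<in> A"
    and "\<forall>h\<in>A. \<forall>a\<in>set h. \<bar>a\<bar> < int n"
    and "card (A - {replicate d 0}) < 2 * (n - 1)"
  shows "cbc_constructible n d A (shadow d A)"
proof (rule cbc_constructibleI[OF assms])
  show "shadow d A s \<subseteq> take s ` A" for s
    by (force simp: shadow_def)
  show "h \<in> shadow d A s" if s: "s < d" and h: "h @ [0] \<in> shadow d A (Suc s)" for s h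
  proof -
    from h obtain g where "length h = s" "length g = d - Suc s" "h @ 0 # g \<in> A"
      by (auto simp: shadow_def)
    with s show ?thesis
      by (auto simp: shadow_def intro!: exI[of _ "0 # g"])
  qed
  show "A \<subseteq> shadow d A d"
    using len by (auto simp: shadow_def)
qed

lemma uminus_sign_changes:
  assumes "h \<in> sign_changes \<Lambda>"
  shows "map uminus h \<in> sign_changes \<Lambda>"
proof -
  from assms obtain \<sigma> k where k: "h = signed \<sigma> k" "k \<in> \<Lambda>" "length \<sigma> = length k" "set \<sigma> \<subseteq> {-1, 1}"
    by (auto simp: sign_changes_def)
  then have "map uminus h = signed (map uminus \<sigma>) k"
    by (auto intro!: nth_equalityI)
  moreover have "set (map uminus \<sigma>) \<subseteq> {-1, 1}" using k(4) by auto
  ultimately show ?thesis using k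
    unfolding sign_changes_def by (intro CollectI exI[of _ "map uminus \<sigma>"] exI[of _ k]) auto
qed

lemma sign_changes_le_max_component:
  assumes "finite \<Lambda>" "h \<in> sign_changes \<Lambda>" "a \<in> set h"
  shows "\<bar>a\<bar> \<le> int (max_component \<Lambda>)"
proof -
  from assms obtain \<sigma> k where k: "h = signed \<sigma> k" "k \<in> \<Lambda>" "set \<sigma> \<subseteq> {-1, 1}"
    by (auto simp: sign_changes_def)
  with assms(3) obtain s m where "a = s * int m" "s \<in> {-1, 1}" "m \<in> set k"
    by (auto dest: set_zip_leftD set_zip_rightD)
  then have "\<bar>a\<bar> = int m" "m \<in> (\<Union>k\<in>\<Lambda>. set k)" using k by auto
  with assms(1) show ?thesis
    by (auto simp: max_component_def intro!: Max_ge)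
qed

theorem lemma18:
  fixes d n :: nat and \<Lambda> :: "nat list set"
  assumes "d \<ge> 1" and "n \<ge> 1"
    and "finite \<Lambda>" and "\<forall>k\<in>\<Lambda>. length k = d"
  shows "(\<forall>z :: int list. length z = d \<longrightarrow>
            (exact_on d \<Lambda> n z \<longleftrightarrow>
             (\<forall>h\<in>sign_changes \<Lambda> - {replicate d 0}. \<not> [dot h z = 0] (mod int n)))) \<and>
         (prime n \<and>
          real n > max (real (card (sign_changes \<Lambda> - {replicate d 0})) / 2 + 1)
                       (real (max_component \<Lambda>)) \<longrightarrow>
            cbc_constructible n d (sign_changes \<Lambda>) (zero_slice d (sign_changes \<Lambda>)) \<and>
            cbc_constructible n d (sign_changes \<Lambda>) (shadow d (sign_changes \<Lambda>)))"
proof (intro conjI allI impI)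
  fix z :: "int list"
  assume "length z = d"
  then show "exact_on d \<Lambda> n z \<longleftrightarrow>
      (\<forall>h\<in>sign_changes \<Lambda> - {replicate d 0}. \<not> [dot h z = 0] (mod int n))"
    using exact_on_iff assms by simp
next
  let ?A = "sign_changes \<Lambda>"
  assume n: "prime n \<and> real n > max (real (card (?A - {replicate d 0})) / 2 + 1)
                       (real (max_component \<Lambda>))"
  have "finite ?A" "\<forall>h\<in>?A. length h = d"
    using assms(3)
    by (auto simp: sign_changes_eq[OF assms(4)] finite_sign_vectors)
       (simp add: sign_vectors_def assms(4))
  moreover have "\<forall>h\<in>?A. \<forall>a\<in>set h. \<bar>a\<bar> < int n"
  proof (intro ballI)
    fix h a assume "h \<in> ?A" "a \<in> set h"
    then have "\<bar>a\<bar> \<le> int (max_component \<Lambda>)"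
      by (rule sign_changes_le_max_component[OF assms(3)])
    also have "\<dots> < int n" using n by simp
    finally show "\<bar>a\<bar> < int n" .
  qed
  moreover have "card (?A - {replicate d 0}) < 2 * (n - 1)"
    using n assms(2) by (simp add: of_nat_diff field_simps) linarith
  ultimately show "cbc_constructible n d ?A (zero_slice d ?A)" "cbc_constructible n d ?A (shadow d ?A)"
    using n uminus_sign_changes
    by (auto intro!: cbc_constructible_zero_slice cbc_constructible_shadow)
qed

end
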